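(* Let $f(\bm\alpha,\bm T)$ be a differentiable scalar function of the Markovian phase type (PH) parameters. Then $$f_\pi(\bm a,\bm\gamma,\bm Z)=f\big(\pi_\alpha(\bm a,\bm\gamma,\bm Z),\,\pi_T(\bm a,\bm\gamma,\bm Z)\big)$$ is a differentiable function of the parameters $\bm a,\bm\gamma,\bm Z$. Consequently, local extremum points of any such function $f$ can be found using gradient descent in the space of the new parametrization $(\bm a,\bm\gamma,\bm Z)$. Once a point is found in the new parametrization, it can be converted back to the Markovian parameter space using the mapping $\pi$. Every extremum point of $f$ corresponds to (possibly multiple) extremum points of $f_\pi$ (via the pre-image of $\pi$), but the opposite direction is not guaranteed; this implies that it may be necessary to sample many starting points for the gradient descent process. (In practice, the authors' experiments show that useful points in the Markovian parametrization are relatively easy to obtain by this method.)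
   Context: The Markovian parameters of a PH distribution of size $n$ are pairs $(\bm\alpha,\bm T)$ with $\bm\alpha\in\mathbb{R}^{1\times n}$ and $\bm T\in\mathbb{R}^{n\times n}$ such that $\alpha_i\ge 0$ for all $i$, $\sum_i\alpha_i=1$, $T_{ij}\ge 0$ for all $i\ne j$, $\sum_j T_{ij}\le 0$ for all $i$, and $\bm T$ is non-singular. The new parameters are $\bm a\in\mathbb{R}^n$, $\bm\gamma\in(\mathbb{R}\setminus\{0\})^n$ and an $n\times n$ real matrix $\bm Z$, and the differentiable map $\pi=(\pi_\alpha,\pi_T)$ to Markovian parameters is $$\pi_\alpha(\bm a,\bm\gamma,\bm Z)=\mathrm{softmax}(\bm a),\qquad \pi_T(\bm a,\bm\gamma,\bm Z)=\mathrm{diag}(\bm\gamma^2)\cdot\left[\mathrm{softmax}(\bm Z)-\left(\bm I_n+\mathrm{softmax}(\bm Z)\circ\bm I_n\right)\right],$$ where $\mathrm{softmax}(\bm v)_i=e^{v_i}/\sum_{j}e^{v_j}$ for vectors and softmax is applied row by row to matrices, $\mathrm{diag}(\bm\gamma^2)$ is the diagonal matrix with $i$-th diagonal element $\gamma_i^2$, $\bm I_n$ is the identity matrix, and $\circ$ is the elementwise matrix product.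
   Formalization: Extrema of f are shown to have preimages only where all Markovian inequalities are strict (others have none). The failing converse is stated for stationary points of f_π, and for extrema of f over unconstrained (α,T). Gradient descent means strict decrease for small steps. *)

theory Defs
  imports "HOL-Analysis.Analysis"
begin

type_synonym 'n ph_params = "(real^'n) \<times> (real^'n^'n)"
type_synonym 'n free_params = "(real^'n) \<times> (real^'n) \<times> (real^'n^'n)"

definition markovian_params :: "'n::finite ph_params set" where
  "markovian_params = {(\<alpha>, T).
     (\<forall>i. 0 \<le> \<alpha> $ i) \<and> (\<Sum>i\<in>UNIV. \<alpha> $ i) = 1 \<and>
     (\<forall>i j. i \<noteq> j \<longrightarrow> 0 \<le> T $ i $ j) \<and> (\<forall>i. (\<Sum>j\<in>UNIV. T $ i $ j) \<le> 0) \<and>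
     invertible T}"

(* The Markovian parameters at which none of the defining inequalities is an equality.
   Since softmax has positive entries, all values of pi_map lie here. *)
definition strict_markovian_params :: "'n::finite ph_params set" where
  "strict_markovian_params = {(\<alpha>, T). (\<alpha>, T) \<in> markovian_params \<and>
     (\<forall>i. 0 < \<alpha> $ i) \<and> (\<forall>i j. i \<noteq> j \<longrightarrow> 0 < T $ i $ j) \<and>
     (\<forall>i. (\<Sum>j\<in>UNIV. T $ i $ j) < 0)}"

definition free_params :: "'n::finite free_params set" where
  "free_params = {(a, \<gamma>, Z). \<forall>i. \<gamma> $ i \<noteq> 0}"

definition softmax :: "real^'n \<Rightarrow> real^'n::finite" where
  "softmax v = (\<chi> i. exp (v $ i) / (\<Sum>j\<in>UNIV. exp (v $ j)))"

definition softmax_rows :: "real^'n^'m \<Rightarrow> real^'n::finite^'m::finite" where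
  "softmax_rows Z = (\<chi> i. softmax (Z $ i))"

definition diag_mat :: "real^'n \<Rightarrow> real^'n^'n::finite" where
  "diag_mat d = (\<chi> i j. if i = j then d $ i else 0)"

definition pi_alpha :: "real^'n \<Rightarrow> real^'n \<Rightarrow> real^'n^'n \<Rightarrow> real^'n::finite" where
  "pi_alpha a \<gamma> Z = softmax a"

(* On the type of matrices, ** is the matrix product and * is the elementwise product. *)
definition pi_T :: "real^'n \<Rightarrow> real^'n \<Rightarrow> real^'n^'n \<Rightarrow> real^'n^'n::finite" where
  "pi_T a \<gamma> Z = diag_mat (\<chi> i. (\<gamma> $ i)\<^sup>2) **
     (softmax_rows Z - (mat 1 + softmax_rows Z * mat 1))"

definition pi_map :: "'n free_params \<Rightarrow> 'n::finite ph_params" where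
  "pi_map = (\<lambda>(a, \<gamma>, Z). (pi_alpha a \<gamma> Z, pi_T a \<gamma> Z))"

definition reparam :: "('n::finite ph_params \<Rightarrow> real) \<Rightarrow> 'n free_params \<Rightarrow> real" where
  "reparam f = (\<lambda>(a, \<gamma>, Z). f (pi_alpha a \<gamma> Z, pi_T a \<gamma> Z))"

definition local_extremum_on ::
    "'a::topological_space set \<Rightarrow> ('a \<Rightarrow> real) \<Rightarrow> 'a \<Rightarrow> bool" where
  "local_extremum_on S f p \<longleftrightarrow> p \<in> S \<and>
     ((\<forall>\<^sub>F q in at p within S. f p \<le> f q) \<or> (\<forall>\<^sub>F q in at p within S. f q \<le> f p))"

end

theory Submission
  imports Defs
begin

text \<open>
  Away from the diagonal the \<open>i\<close>-th row of \<^term>\<open>pi_T a \<gamma> Z\<close> is a positive multiple of a softmax, and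
  its diagonal entry is \<open>- \<gamma>\<^sub>i\<^sup>2\<close>; the row is strictly diagonally dominant because the softmax leaves
  positive mass on the diagonal. Hence the smooth map \<open>\<pi>\<close> sends the open set of free parameters into
  the Markovian ones, and all positive statements follow from the chain rule and from continuity
  of \<open>\<pi>\<close>. Conversely, logarithms of the entries invert \<open>\<pi>\<close> over strict Markovian parameters, where
  the sign of \<open>\<gamma>\<close> is immaterial. The cube \<open>(1 + T\<^sub>i\<^sub>i)\<^sup>3\<close> becomes \<open>(1 - \<gamma>\<^sub>i\<^sup>2)\<^sup>3\<close>, with an inflection at
  \<open>\<gamma>\<^sub>i = 1\<close>, and \<open>\<Sum>\<^sub>i \<alpha>\<^sub>i\<close> becomes constant: these two functions have no extremum in the original space
  at the image of a critical point, respectively of an extremum.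
\<close>

text \<open>Levy-Desplanques: in a row \<open>i\<close> where a kernel vector \<open>x\<close> has
  maximal modulus, a nonzero \<open>x $ i\<close> would make the diagonal term outweigh all the
  others, so the kernel is trivial.\<close>

lemma strictly_diagonally_dominant_invertible:
  fixes A :: "real^'n::finite^'n"
  assumes dom: "\<And>i. (\<Sum>j\<in>UNIV - {i}. \<bar>A $ i $ j\<bar>) < \<bar>A $ i $ i\<bar>"
  shows "invertible A"
  unfolding invertible_left_inverse matrix_left_invertible_ker
proof (intro allI impI)
  fix x :: "real^'n" assume Ax: "A *v x = 0"
  have "Max (range (\<lambda>i. \<bar>x $ i\<bar>)) \<in> range (\<lambda>i. \<bar>x $ i\<bar>)" by (intro Max_in) auto
  then obtain i where "\<bar>x $ i\<bar> = Max (range (\<lambda>i. \<bar>x $ i\<bar>))" by (metis imageE)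
  then have i: "\<bar>x $ j\<bar> \<le> \<bar>x $ i\<bar>" for j by simp
  have "(\<Sum>j\<in>UNIV. A $ i $ j * x $ j) = 0"
    using arg_cong[OF Ax, of "\<lambda>v. v $ i"] by (simp add: matrix_vector_mult_def)
  then have "A $ i $ i * x $ i = - (\<Sum>j\<in>UNIV - {i}. A $ i $ j * x $ j)"
    by (simp add: sum.remove[of UNIV i])
  then have "\<bar>A $ i $ i\<bar> * \<bar>x $ i\<bar> = \<bar>\<Sum>j\<in>UNIV - {i}. A $ i $ j * x $ j\<bar>"
    by (metis abs_minus_cancel abs_mult)
  also have "\<dots> \<le> (\<Sum>j\<in>UNIV - {i}. \<bar>A $ i $ j\<bar> * \<bar>x $ j\<bar>)"
    by (rule order_trans[OF sum_abs]) (simp add: abs_mult)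
  also have "\<dots> \<le> (\<Sum>j\<in>UNIV - {i}. \<bar>A $ i $ j\<bar> * \<bar>x $ i\<bar>)"
    by (intro sum_mono mult_left_mono i) auto
  finally have "\<bar>A $ i $ i\<bar> * \<bar>x $ i\<bar> \<le> (\<Sum>j\<in>UNIV - {i}. \<bar>A $ i $ j\<bar>) * \<bar>x $ i\<bar>"
    by (simp add: sum_distrib_right)
  \<comment> \<open>Multiplying the strict dominance inequality by a positive
    \<open>\<bar>x $ i\<bar>\<close> would contradict the bound just obtained.\<close>
  then have "\<not> 0 < \<bar>x $ i\<bar>"
    using dom[of i] mult_strict_right_mono[of _ _ "\<bar>x $ i\<bar>"] by (meson not_less)
  then show "x = 0" using i by (simp add: vec_eq_iff)
qed

section \<open>Gradients, descent directions and local extrema\<close>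

lemma differentiable_imp_gderiv:
  fixes f :: "'a::euclidean_space \<Rightarrow> real"
  assumes "f differentiable at x"
  shows "\<exists>D. GDERIV f x :> D"
proof -
  from assms obtain f' where f': "(f has_derivative f') (at x)"
    by (auto simp: differentiable_def)
  \<comment> \<open>Riesz representation of the derivative: the gradient is the adjoint applied to
    \<open>1\<close>.\<close>
  have "f' h = inner h (adjoint f' 1)" for h
    using adjoint_works[OF has_derivative_linear[OF f'], of h 1] by simp
  then have "f' = (\<lambda>h. inner h (adjoint f' 1))" by blast
  with f' show ?thesis unfolding gderiv_def by metis
qed

text \<open>On the ray from \<open>x\<close> in direction \<open>- D\<close> the one-variable
  derivative at \<open>0\<close> is \<open>- inner D D\<close>, hence negative; openness of
  \<open>S\<close> keeps short steps inside.\<close>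

lemma gderiv_descent:
  fixes f :: "'a::euclidean_space \<Rightarrow> real"
  assumes D: "GDERIV f x :> D" and "D \<noteq> 0" and "open S" "x \<in> S"
  shows "\<exists>e>0. \<forall>t\<in>{0<..<e}. x - t *\<^sub>R D \<in> S \<and> f (x - t *\<^sub>R D) < f x"
proof -
  have "((\<lambda>t::real. x - t *\<^sub>R D) has_derivative (\<lambda>t. - (t *\<^sub>R D))) (at 0)"
    by (auto intro!: derivative_eq_intros)
  moreover have "(f has_derivative (\<lambda>h. inner h D)) (at (x - 0 *\<^sub>R D))"
    using D by (simp add: gderiv_def)
  ultimately have "((\<lambda>t. f (x - t *\<^sub>R D)) has_derivative (\<lambda>t. inner (- (t *\<^sub>R D)) D)) (at 0)"
    by (rule has_derivative_compose)
  then have "((\<lambda>t. f (x - t *\<^sub>R D)) has_real_derivative - inner D D) (at 0)"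
    by (rule has_derivative_imp_has_field_derivative) simp
  moreover have "- inner D D < 0" using \<open>D \<noteq> 0\<close> by simp
  ultimately obtain d where d: "d > 0" "\<And>h. 0 < h \<Longrightarrow> h < d \<Longrightarrow> f (x - h *\<^sub>R D) < f x"
    by (auto dest!: DERIV_neg_dec_right)
  have "((\<lambda>t. x - t *\<^sub>R D) \<longlongrightarrow> x - 0 *\<^sub>R D) (at_right 0)" by (intro tendsto_intros)
  then have "\<forall>\<^sub>F t in at_right 0. x - t *\<^sub>R D \<in> S"
    using topological_tendstoD \<open>open S\<close> \<open>x \<in> S\<close> by fastforce
  then obtain b where b: "b > 0" "\<And>t. 0 < t \<Longrightarrow> t < b \<Longrightarrow> x - t *\<^sub>R D \<in> S"
    unfolding eventually_at_right_field by auto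
  from b d show ?thesis by (intro exI[of _ "min b d"]) auto
qed

lemma differentiable_imp_continuous_at:
  "f differentiable at x \<Longrightarrow> (f \<longlongrightarrow> f x) (at x)"
  using differentiable_imp_continuous_within[of f x UNIV] by (simp add: continuous_within)

lemma gderiv_zero_of_local_extremum:
  assumes ext: "local_extremum_on S f x" and "open S" and D: "GDERIV f x :> D"
  shows "D = 0"
proof -
  have x: "x \<in> S" using ext by (simp add: local_extremum_on_def)
  \<comment> \<open>\<open>at x\<close> only sees punctured neighbourhoods; the inequality holds
    trivially at \<open>x\<close> itself, which gives the full neighbourhood needed for Fermat's
    theorem.\<close>
  have "eventually P (at x) \<Longrightarrow> P x \<Longrightarrow> \<exists>U. open U \<and> x \<in> U \<and> (\<forall>y\<in>U. P y)" for P
    unfolding eventually_at_topological by (metis UNIV_I)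
  from this[of "\<lambda>y. f x \<le> f y"] this[of "\<lambda>y. f y \<le> f x"]
  have "\<exists>U. open U \<and> x \<in> U \<and> ((\<forall>y\<in>U. f y \<le> f x) \<or> (\<forall>y\<in>U. f x \<le> f y))"
    using ext unfolding local_extremum_on_def at_within_open[OF x \<open>open S\<close>] by auto
  then obtain U where "open U" "x \<in> U" "(\<forall>y\<in>U. f y \<le> f x) \<or> (\<forall>y\<in>U. f x \<le> f y)" by blast
  then have "(\<lambda>h. inner h D) = (\<lambda>v. 0)"
    using D differential_zero_maxmin[of x U f "\<lambda>h. inner h D"] by (simp add: gderiv_def)
  then show ?thesis by (metis inner_eq_zero_iff)
qed

text \<open>Continuity pulls the neighbourhood of \<open>g x\<close> back to one of
  \<open>x\<close>. The map \<open>g\<close> may send points other than \<open>x\<close> to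
  \<open>g x\<close>, where the two values of \<open>f\<close> agree.\<close>

lemma local_extremum_on_compose:
  assumes ext: "local_extremum_on T f (g x)" and "x \<in> S" "g ` S \<subseteq> T"
    and g: "(g \<longlongrightarrow> g x) (at x within S)"
  shows "local_extremum_on S (\<lambda>y. f (g y)) x"
proof -
  have pull: "\<forall>\<^sub>F y in at x within S. P (g y)"
    if "\<forall>\<^sub>F q in at (g x) within T. P q" "P (g x)" for P
  proof -
    from that obtain U where U: "open U" "g x \<in> U" "\<And>q. q \<in> U \<Longrightarrow> q \<in> T \<Longrightarrow> P q"
      unfolding eventually_at_topological by metis
    have "\<forall>\<^sub>F y in at x within S. g y \<in> U" by (rule topological_tendstoD[OF g U(1,2)])
    moreover have "\<forall>\<^sub>F y in at x within S. y \<in> S" by (simp add: eventually_at_topological) auto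
    ultimately show ?thesis by eventually_elim (use U(3) assms(3) in auto)
  qed
  then show ?thesis
    using ext \<open>x \<in> S\<close> pull[of "\<lambda>q. f (g x) \<le> f q"] pull[of "\<lambda>q. f q \<le> f (g x)"]
    unfolding local_extremum_on_def by auto
qed

section \<open>Differentiability of pairs and vectors\<close>

lemma differentiable_Pair:
  assumes "f differentiable (at a within S)" "g differentiable (at a within S)"
  shows "(\<lambda>x. (f x, g x)) differentiable (at a within S)"
  using assms unfolding differentiable_def by (blast intro: has_derivative_Pair)

lemma differentiable_vec_lambda:
  fixes f :: "'i::finite \<Rightarrow> 'a::real_normed_vector \<Rightarrow> 'b::euclidean_space"
  assumes "\<And>i. f i differentiable (at a within S)"
  shows "(\<lambda>x. \<chi> i. f i x) differentiable (at a within S)"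
proof -
  have "(\<lambda>x. f i x \<bullet> b) differentiable (at a within S)" for i b
    using assms[of i] unfolding differentiable_def by (blast intro: has_derivative_inner_left)
  then show ?thesis
    by (subst differentiable_componentwise_within) (auto simp: Basis_vec_def inner_axis)
qed

section \<open>Softmax: positivity, normalization, inversion by logarithms, smoothness\<close>

lemma softmax_pos: "0 < softmax v $ i"
  unfolding softmax_def by (simp add: sum_pos)

lemma softmax_sum: "(\<Sum>i\<in>UNIV. softmax v $ i) = 1"
proof -
  have "(\<Sum>j\<in>UNIV. exp (v $ j)) > (0::real)" by (intro sum_pos) auto
  then show ?thesis by (simp add: softmax_def flip: sum_divide_distrib)
qed

lemma softmax_ln:
  assumes "\<And>i. 0 < p $ i" "(\<Sum>i\<in>UNIV. p $ i) = 1"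
  shows "softmax (\<chi> i. ln (p $ i)) = p"
  using assms by (simp add: softmax_def vec_eq_iff)

lemma differentiable_softmax:
  fixes v :: "real^'n::finite"
  shows "softmax differentiable at v"
proof -
  have e: "(\<lambda>v::real^'n. exp (v $ i)) differentiable at v" for i
    by (rule differentiable_compose[of exp])
      (auto simp: real_differentiable_def intro: DERIV_exp bounded_linear_imp_differentiable)
  have "(\<Sum>j\<in>UNIV. exp (v $ j)) > (0::real)" by (intro sum_pos) auto
  then show ?thesis
    unfolding softmax_def by (intro differentiable_vec_lambda differentiable_divide differentiable_sum ballI e) auto
qed

section \<open>Entries, row sums and range of \<open>pi_map\<close>\<close>

lemma pi_T_nth:
  "pi_T a \<gamma> Z $ i $ j = (if i = j then - (\<gamma> $ i)\<^sup>2 else (\<gamma> $ i)\<^sup>2 * softmax (Z $ i) $ j)"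
proof -
  have "pi_T a \<gamma> Z $ i $ j
      = (\<gamma> $ i)\<^sup>2 * (softmax (Z $ i) $ j - (mat 1 $ i $ j + softmax (Z $ i) $ j * mat 1 $ i $ j))"
    by (simp add: pi_T_def diag_mat_def matrix_matrix_mult_def softmax_rows_def
        if_distrib[of "\<lambda>c. c * _"] cong: if_cong)
  \<comment> \<open>On the diagonal the elementwise product with \<open>mat 1\<close> cancels the
    softmax entry, leaving only the \<open>- 1\<close> of the identity.\<close>
  then show ?thesis by (auto simp: mat_def algebra_simps)
qed

lemma pi_T_row_sum: "(\<Sum>j\<in>UNIV. pi_T a \<gamma> Z $ i $ j) = - ((\<gamma> $ i)\<^sup>2 * softmax (Z $ i) $ i)"
proof -
  have "(\<Sum>j\<in>UNIV - {i}. pi_T a \<gamma> Z $ i $ j) = (\<gamma> $ i)\<^sup>2 * (\<Sum>j\<in>UNIV - {i}. softmax (Z $ i) $ j)"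
    by (simp add: pi_T_nth sum_distrib_left)
  also have "(\<Sum>j\<in>UNIV - {i}. softmax (Z $ i) $ j) = 1 - softmax (Z $ i) $ i"
    using softmax_sum[of "Z $ i"] by (simp add: sum.remove[of UNIV i])
  finally show ?thesis by (simp add: sum.remove[of UNIV i] pi_T_nth algebra_simps)
qed

text \<open>With nonnegative off-diagonal entries, a negative row sum says exactly that
  \<open>- T $ i $ i\<close> exceeds the sum of the other moduli in the row.\<close>

lemma invertible_of_neg_row_sums:
  fixes T :: "real^'n::finite^'n"
  assumes "\<And>i j. i \<noteq> j \<Longrightarrow> 0 \<le> T $ i $ j" "\<And>i. (\<Sum>j\<in>UNIV. T $ i $ j) < 0"
  shows "invertible T"
proof (rule strictly_diagonally_dominant_invertible)
  fix i
  have "(\<Sum>j\<in>UNIV - {i}. \<bar>T $ i $ j\<bar>) = (\<Sum>j\<in>UNIV - {i}. T $ i $ j)"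
    by (intro sum.cong) (auto simp: assms(1))
  also have "\<dots> < - T $ i $ i" using assms(2)[of i] by (simp add: sum.remove[of UNIV i])
  finally show "(\<Sum>j\<in>UNIV - {i}. \<bar>T $ i $ j\<bar>) < \<bar>T $ i $ i\<bar>" by linarith
qed

lemma pi_map_mem:
  fixes x :: "'n::finite free_params"
  assumes "x \<in> free_params"
  shows "pi_map x \<in> markovian_params"
proof -
  obtain a \<gamma> Z where x: "x = (a, \<gamma>, Z)" by (cases x)
  have \<gamma>: "\<gamma> $ i \<noteq> 0" for i using assms by (simp add: x free_params_def)
  have off: "0 \<le> pi_T a \<gamma> Z $ i $ j" if "i \<noteq> j" for i j
    using that softmax_pos[of "Z $ i" j] by (simp add: pi_T_nth)
  have row: "(\<Sum>j\<in>UNIV. pi_T a \<gamma> Z $ i $ j) < 0" for i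
    using \<gamma>[of i] softmax_pos[of "Z $ i" i] by (simp add: pi_T_row_sum)
  show ?thesis
    using off row invertible_of_neg_row_sums[OF off row]
    by (auto simp: x pi_map_def markovian_params_def pi_alpha_def softmax_sum
        intro: less_imp_le softmax_pos)
qed

section \<open>Differentiability of \<open>pi_map\<close> and transfer of extrema to
  \<open>reparam f\<close>\<close>

lemma reparam_eq: "reparam f = (\<lambda>x. f (pi_map x))"
  by (auto simp: reparam_def pi_map_def)

lemma bounded_linear_params_nth:
  "bounded_linear (\<lambda>x::'n::finite free_params. fst (snd x) $ i)"
  "bounded_linear (\<lambda>x::'n free_params. snd (snd x) $ i)"
  "bounded_linear (\<lambda>p::'n ph_params. snd p $ i $ j)"
proof -
  note nth = bounded_linear_compose[OF bounded_linear_vec_nth]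
  show "bounded_linear (\<lambda>x::'n free_params. fst (snd x) $ i)"
    by (rule nth[OF bounded_linear_compose[OF bounded_linear_fst bounded_linear_snd]])
  show "bounded_linear (\<lambda>x::'n free_params. snd (snd x) $ i)"
    by (rule nth[OF bounded_linear_compose[OF bounded_linear_snd bounded_linear_snd]])
  show "bounded_linear (\<lambda>p::'n ph_params. snd p $ i $ j)"
    by (rule nth[OF nth[OF bounded_linear_snd]])
qed

lemma differentiable_pi_map:
  fixes x :: "'n::finite free_params"
  shows "pi_map differentiable at x"
proof -
  have \<alpha>: "(\<lambda>x::'n free_params. softmax (fst x)) differentiable at x"
    by (intro differentiable_compose[OF differentiable_softmax] bounded_linear_imp_differentiable
        bounded_linear_fst)
  have \<gamma>: "(\<lambda>x::'n free_params. (fst (snd x) $ i)\<^sup>2) differentiable at x" for i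
    by (intro differentiable_power bounded_linear_imp_differentiable bounded_linear_params_nth)
  have S: "(\<lambda>x::'n free_params. softmax (snd (snd x) $ i) $ j) differentiable at x" for i j
    by (intro differentiable_compose[OF bounded_linear_imp_differentiable[OF bounded_linear_vec_nth]]
        differentiable_compose[OF differentiable_softmax] bounded_linear_imp_differentiable
        bounded_linear_params_nth)
  have entry: "(\<lambda>x::'n free_params. if i = j then - (fst (snd x) $ i)\<^sup>2
      else (fst (snd x) $ i)\<^sup>2 * softmax (snd (snd x) $ i) $ j) differentiable at x" for i j
    by (cases "i = j") (simp_all only: if_True if_False refl differentiable_minus differentiable_mult \<gamma> S)
  have "pi_map = (\<lambda>x::'n free_params. (softmax (fst x), \<chi> i j. if i = j then - (fst (snd x) $ i)\<^sup>2
      else (fst (snd x) $ i)\<^sup>2 * softmax (snd (snd x) $ i) $ j))"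
    by (auto simp: pi_map_def pi_alpha_def vec_eq_iff pi_T_nth)
  moreover have "(\<lambda>x::'n free_params. (softmax (fst x), \<chi> i j. if i = j then - (fst (snd x) $ i)\<^sup>2
      else (fst (snd x) $ i)\<^sup>2 * softmax (snd (snd x) $ i) $ j)) differentiable at x"
    by (intro differentiable_Pair \<alpha> differentiable_vec_lambda entry)
  ultimately show ?thesis by simp
qed

lemma open_free_params: "open (free_params :: 'n::finite free_params set)"
proof -
  have eq: "free_params = (\<Inter>i. {x::'n free_params. fst (snd x) $ i \<noteq> 0})"
    by (auto simp: free_params_def)
  have "open {x::'n free_params. fst (snd x) $ i \<noteq> 0}" for i
    by (intro open_Collect_neq linear_continuous_on bounded_linear_params_nth continuous_on_const)
  then show ?thesis
    unfolding eq by (intro open_INT) auto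
qed

lemma differentiable_reparam:
  assumes "f differentiable_on markovian_params" "x \<in> free_params"
  shows "reparam f differentiable at x"
proof -
  \<comment> \<open>Differentiability of \<open>f\<close> is only relative to the Markovian set, so
    the chain rule runs within the image of \<open>pi_map\<close>; openness of
    \<open>free_params\<close> then removes the restriction at \<open>x\<close>.\<close>
  have "f differentiable (at (pi_map x) within pi_map ` free_params)"
    using assms pi_map_mem by (blast intro: differentiable_subset differentiable_onD)
  then have "(\<lambda>x. f (pi_map x)) differentiable (at x within free_params)"
    by (rule differentiable_in_compose) (rule differentiable_at_withinI[OF differentiable_pi_map])
  then show ?thesis
    by (simp add: reparam_eq at_within_open[OF assms(2) open_free_params])
qed

lemma local_extremum_reparam:
  fixes x :: "'n::finite free_params"
  assumes "local_extremum_on markovian_params f (pi_map x)" "x \<in> free_params"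
  shows "local_extremum_on free_params (reparam f) x"
  unfolding reparam_eq
proof (rule local_extremum_on_compose[where g = pi_map and f = f, OF assms])
  show "pi_map ` free_params \<subseteq> (markovian_params :: 'n ph_params set)" by (auto simp: pi_map_mem)
  show "(pi_map \<longlongrightarrow> pi_map x) (at x within free_params)"
    unfolding at_within_open[OF assms(2) open_free_params]
    by (rule differentiable_imp_continuous_at[OF differentiable_pi_map])
qed

lemma gderiv_zero_of_local_extremum_reparam:
  assumes "f differentiable_on markovian_params" "x \<in> free_params"
    and "local_extremum_on markovian_params f (pi_map x)"
  shows "GDERIV (reparam f) x :> 0"
  using differentiable_imp_gderiv[OF differentiable_reparam[OF assms(1,2)]]
    gderiv_zero_of_local_extremum[OF local_extremum_reparam[OF assms(3,2)] open_free_params]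
  by metis

text \<open>The entries of \<open>\<gamma>\<close> must square to \<open>- T $ i $ i\<close>;
  dividing each row by this number and taking logarithms recovers \<open>Z\<close>. The two
  preimages differ in the sign of \<open>\<gamma>\<close>.\<close>

lemma two_preimages_of_strict:
  assumes "p \<in> strict_markovian_params"
  shows "\<exists>x\<in>free_params. \<exists>y\<in>free_params. x \<noteq> y \<and> pi_map x = p \<and> pi_map y = p"
proof -
  obtain \<alpha> T where p: "p = (\<alpha>, T)" by (cases p)
  have \<alpha>: "\<And>i. 0 < \<alpha> $ i" "(\<Sum>i\<in>UNIV. \<alpha> $ i) = 1"
    and off: "\<And>i j. i \<noteq> j \<Longrightarrow> 0 < T $ i $ j" and row: "\<And>i. (\<Sum>j\<in>UNIV. T $ i $ j) < 0"
    using assms by (auto simp: p strict_markovian_params_def markovian_params_def)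
  have diag: "T $ i $ i < 0" for i
    using row[of i] sum_nonneg[of "UNIV - {i}" "\<lambda>j. T $ i $ j"] less_imp_le[OF off]
    by (force simp: sum.remove[of UNIV i])
  \<comment> \<open>The diagonal of \<open>T\<close> does not determine that of the softmax
    directly; the negated row sum is the mass missing there, by \<open>pi_T_row_sum\<close>.\<close>
  define P :: "real^'a^'a" where "P = (\<chi> i j. (if i = j then - (\<Sum>k\<in>UNIV. T $ i $ k) else T $ i $ j) / - T $ i $ i)"
  have P_pos: "0 < P $ i $ j" for i j
    using off[of i j] row[of i] diag[of i] unfolding P_def by (auto intro: divide_pos_neg divide_neg_neg)
  have P_sum: "(\<Sum>j\<in>UNIV. P $ i $ j) = 1" for i
  proof -
    have "(\<Sum>j\<in>UNIV - {i}. P $ i $ j) = (\<Sum>j\<in>UNIV - {i}. T $ i $ j) / - T $ i $ i"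
      by (simp add: P_def sum_divide_distrib sum_negf)
    then show ?thesis
      using diag[of i] by (simp add: sum.remove[of UNIV i] P_def field_simps)
  qed
  define Z :: "real^'a^'a" where "Z = (\<chi> i j. ln (P $ i $ j))"
  have Z: "softmax (Z $ i) = P $ i" for i
    unfolding Z_def using softmax_ln[OF P_pos P_sum] by simp
  define a where "a = (\<chi> i. ln (\<alpha> $ i))"
  define c where "c = (\<chi> i. sqrt (- T $ i $ i))"
  have c: "(c $ i)\<^sup>2 = - T $ i $ i" "c $ i \<noteq> 0" for i using diag[of i] by (auto simp: c_def)
  have pi: "pi_map (a, \<gamma>, Z) = p" if \<gamma>: "\<And>i. (\<gamma> $ i)\<^sup>2 = - T $ i $ i" for \<gamma>
  proof -
    have "pi_T a \<gamma> Z $ i $ j = T $ i $ j" for i j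
      using diag[of i] by (simp add: pi_T_nth \<gamma> Z P_def)
    then show ?thesis using softmax_ln[OF \<alpha>] by (simp add: p pi_map_def pi_alpha_def a_def vec_eq_iff)
  qed
  have "c \<noteq> - c" using c(2) by (auto simp: vec_eq_iff)
  then show ?thesis
    by (intro bexI[of _ "(a, c, Z)"] bexI[of _ "(a, - c, Z)"] conjI pi) (auto simp: c free_params_def)
qed

section \<open>Counterexamples to the converse direction\<close>

lemma not_local_extremum_on:
  fixes u :: "real \<Rightarrow> 'a::topological_space"
  assumes u: "isCont u 0" and S: "\<And>t. u t \<in> S"
    and less: "\<forall>\<^sub>F t in at_right 0. f (u t) < f (u 0)"
    and greater: "\<forall>\<^sub>F t in at_left 0. f (u 0) < f (u t)"
  shows "\<not> local_extremum_on S f (u 0)"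
proof
  assume "local_extremum_on S f (u 0)"
  \<comment> \<open>An extremum would persist along the curve, but a function of \<open>t\<close>
    crossing its value at \<open>0\<close> has none; the one-sided filters at \<open>0\<close> are
    nontrivial.\<close>
  then have "local_extremum_on UNIV (\<lambda>t. f (u t)) 0"
    using u S by (intro local_extremum_on_compose[where g = u and f = f and T = S]) (auto simp: isCont_def)
  then consider "\<forall>\<^sub>F t in at 0. f (u 0) \<le> f (u t)" | "\<forall>\<^sub>F t in at 0. f (u t) \<le> f (u 0)"
    by (auto simp: local_extremum_on_def)
  then show False
  proof cases
    case 1
    then have "\<forall>\<^sub>F t in at_right 0. f (u 0) \<le> f (u t)" by (simp add: eventually_at_split)
    with less have "\<forall>\<^sub>F t in at_right (0::real). False" by eventually_elim auto
    then show False by simp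
  next
    case 2
    then have "\<forall>\<^sub>F t in at_left 0. f (u t) \<le> f (u 0)" by (simp add: eventually_at_split)
    with greater have "\<forall>\<^sub>F t in at_left (0::real). False" by eventually_elim auto
    then show False by simp
  qed
qed

lemma critical_point_not_extremum:
  fixes i :: "'n::finite"
  defines "g \<equiv> \<lambda>p::'n ph_params. (1 + snd p $ i $ i) ^ 3"
  shows "g differentiable_on S"
    and "\<exists>x\<in>free_params. GDERIV (reparam g) x :> 0 \<and>
             \<not> local_extremum_on markovian_params g (pi_map x)"
proof -
  show "g differentiable_on S"
    unfolding g_def by (intro differentiable_at_imp_differentiable_on differentiable_power
        differentiable_add differentiable_const bounded_linear_imp_differentiable bounded_linear_params_nth)
  \<comment> \<open>The curve passes through the inflection \<open>\<gamma> $ i = 1\<close> at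
    \<open>t = 0\<close>, and \<open>exp\<close> keeps every entry nonzero for all
    \<open>t\<close>.\<close>
  define u :: "real \<Rightarrow> 'n free_params" where "u t = (0, (\<chi> j. exp t), 0)" for t
  have free: "u t \<in> free_params" for t by (simp add: u_def free_params_def)
  have g_u: "g (pi_map (u t)) = (1 - (exp t)\<^sup>2) ^ 3" for t
    by (simp add: g_def u_def pi_map_def pi_T_nth)
  have rep: "reparam g = (\<lambda>x. (1 - (fst (snd x) $ i)\<^sup>2) ^ 3)"
    by (auto simp: reparam_def g_def pi_T_nth)
  \<comment> \<open>The derivative \<open>- 6 * c * (1 - c\<^sup>2)\<^sup>2\<close> vanishes at
    \<open>c = 1\<close>, although the odd power changes sign there.\<close>
  have "((\<lambda>c::real. (1 - c\<^sup>2) ^ 3) has_real_derivative 0) (at (fst (snd (u 0)) $ i))"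
    by (auto intro!: derivative_eq_intros simp: u_def)
  from DERIV_compose_FDERIV[OF this bounded_linear_imp_has_derivative[OF bounded_linear_params_nth(1)]]
  have "((\<lambda>x::'n free_params. (1 - (fst (snd x) $ i)\<^sup>2) ^ 3) has_derivative (\<lambda>h. 0)) (at (u 0))"
    by simp
  then have crit: "GDERIV (reparam g) (u 0) :> 0" by (simp add: rep gderiv_def)
  have "\<not> local_extremum_on markovian_params g (pi_map (u 0))"
  proof (rule not_local_extremum_on[where u = "\<lambda>t. pi_map (u t)"])
    have "isCont u 0"
      unfolding u_def isCont_def by (intro tendsto_intros tendsto_vec_lambda)
    moreover have "isCont pi_map (u 0)"
      using differentiable_imp_continuous_at[OF differentiable_pi_map] by (simp add: isCont_def)
    ultimately show "isCont (\<lambda>t. pi_map (u t)) 0" by (rule isCont_o2)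
    show "pi_map (u t) \<in> markovian_params" for t by (rule pi_map_mem[OF free])
    show "\<forall>\<^sub>F t in at_right 0. g (pi_map (u t)) < g (pi_map (u 0))"
      unfolding eventually_at_right_field
    proof (intro exI[of _ 1] conjI allI impI)
      fix t :: real assume "0 < t"
      then have "1 - (exp t)\<^sup>2 < 0" by (simp add: one_less_power)
      then show "g (pi_map (u t)) < g (pi_map (u 0))" by (simp add: g_u power_less_zero_eq)
    qed simp
    show "\<forall>\<^sub>F t in at_left 0. g (pi_map (u 0)) < g (pi_map (u t))"
      unfolding eventually_at_left_field
    proof (intro exI[of _ "-1"] conjI allI impI)
      fix t :: real assume "t < 0"
      then have "0 < 1 - (exp t)\<^sup>2" by (simp add: power_less_one_iff)
      then show "g (pi_map (u 0)) < g (pi_map (u t))" by (simp add: g_u)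
    qed simp
  qed
  with crit free show "\<exists>x\<in>free_params. GDERIV (reparam g) x :> 0 \<and>
             \<not> local_extremum_on markovian_params g (pi_map x)" by blast
qed

lemma extremum_not_extremum_on_UNIV:
  defines "g \<equiv> \<lambda>p::'n::finite ph_params. \<Sum>i\<in>UNIV. fst p $ i"
  shows "g differentiable_on S"
    and "\<exists>x\<in>free_params. local_extremum_on free_params (reparam g) x \<and>
             \<not> local_extremum_on UNIV g (pi_map x)"
proof -
  show "g differentiable_on S"
    unfolding g_def
    by (intro differentiable_at_imp_differentiable_on differentiable_sum ballI
        bounded_linear_imp_differentiable bounded_linear_compose[OF bounded_linear_vec_nth]
        bounded_linear_fst) auto
  define x :: "'n free_params" where "x = (0, (\<chi> j. 1), 0)"
  have x: "x \<in> free_params" by (simp add: x_def free_params_def)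
  \<comment> \<open>Extrema are meant in the weak sense, so a constant function has one at every
    point.\<close>
  have "reparam g = (\<lambda>x. 1)" by (auto simp: reparam_def g_def pi_alpha_def softmax_sum)
  then have ext: "local_extremum_on free_params (reparam g) x"
    using x by (simp add: local_extremum_on_def)
  \<comment> \<open>For \<open>t \<noteq> 0\<close> the curve leaves the simplex of probability
    vectors, so it tests extremality in the ambient space; \<open>g\<close> decreases linearly along
    it.\<close>
  define u :: "real \<Rightarrow> 'n ph_params" where "u t = (fst (pi_map x) - (\<chi> j. t), snd (pi_map x))" for t
  have "\<not> local_extremum_on UNIV g (u 0)"
  proof (rule not_local_extremum_on)
    show "isCont u 0"
      unfolding u_def isCont_def by (intro tendsto_intros tendsto_vec_lambda)
    show "\<forall>\<^sub>F t in at_right 0. g (u t) < g (u 0)"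
      unfolding eventually_at_right_field
      by (intro exI[of _ 1]) (auto simp: g_def u_def sum_subtractf)
    show "\<forall>\<^sub>F t in at_left 0. g (u 0) < g (u t)"
      unfolding eventually_at_left_field
      by (intro exI[of _ "-1"]) (auto simp: g_def u_def sum_subtractf mult_pos_neg)
  qed auto
  moreover have "u 0 = pi_map x" by (simp add: u_def prod_eq_iff vec_eq_iff)
  ultimately show "\<exists>x\<in>free_params. local_extremum_on free_params (reparam g) x \<and>
             \<not> local_extremum_on UNIV g (pi_map x)"
    using x ext by auto
qed

text \<open>The last two conjuncts express the failure of the converse: a critical point whose image
  is no extremum over the Markovian set, and an extremum whose image is none in the ambient
  space.\<close>

theorem corollary1:
  fixes f :: "'n::finite ph_params \<Rightarrow> real"
  assumes "f differentiable_on markovian_params"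
  shows
    "reparam f differentiable_on free_params
     \<and> (\<forall>x\<in>free_params. \<exists>D. GDERIV (reparam f) x :> D \<and>
          (D \<noteq> 0 \<longrightarrow> (\<exists>e>0. \<forall>t\<in>{0<..<e}.
             x - t *\<^sub>R D \<in> free_params \<and> reparam f (x - t *\<^sub>R D) < reparam f x)))
     \<and> (\<forall>x\<in>free_params. pi_map x \<in> (markovian_params :: 'n ph_params set)
          \<and> f (pi_map x) = reparam f x)
     \<and> (\<forall>p. local_extremum_on markovian_params f p \<longrightarrow>
          (\<forall>x\<in>free_params. pi_map x = p \<longrightarrow>
             local_extremum_on free_params (reparam f) x \<and> GDERIV (reparam f) x :> 0)
          \<and> (p \<in> strict_markovian_params \<longrightarrow>
             (\<exists>x\<in>free_params. \<exists>y\<in>free_params. x \<noteq> y \<and> pi_map x = p \<and> pi_map y = p)))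
     \<and> (\<exists>g :: 'n ph_params \<Rightarrow> real. g differentiable_on markovian_params \<and>
          (\<exists>x\<in>free_params. GDERIV (reparam g) x :> 0 \<and>
             \<not> local_extremum_on markovian_params g (pi_map x)))
     \<and> (\<exists>g :: 'n ph_params \<Rightarrow> real. g differentiable_on UNIV \<and>
          (\<exists>x\<in>free_params. local_extremum_on free_params (reparam g) x \<and>
             \<not> local_extremum_on UNIV g (pi_map x)))"
proof (intro conjI ballI allI impI)
  show "reparam f differentiable_on free_params"
    using differentiable_reparam[OF assms] by (intro differentiable_at_imp_differentiable_on)
  show "\<exists>D. GDERIV (reparam f) x :> D \<and>
          (D \<noteq> 0 \<longrightarrow> (\<exists>e>0. \<forall>t\<in>{0<..<e}.
             x - t *\<^sub>R D \<in> free_params \<and> reparam f (x - t *\<^sub>R D) < reparam f x))"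
    if "x \<in> free_params" for x
    using differentiable_imp_gderiv[OF differentiable_reparam[OF assms that]]
      gderiv_descent[OF _ _ open_free_params that] by metis
  show "pi_map x \<in> (markovian_params :: 'n ph_params set)" if "x \<in> free_params" for x
    by (rule pi_map_mem[OF that])
  show "f (pi_map x) = reparam f x" for x by (simp add: reparam_eq)
  show "local_extremum_on free_params (reparam f) x" "GDERIV (reparam f) x :> 0"
    if "local_extremum_on markovian_params f p" "x \<in> free_params" "pi_map x = p" for p x
    using that local_extremum_reparam[of f x] gderiv_zero_of_local_extremum_reparam[OF assms, of x]
    by simp_all
  show "\<exists>x\<in>free_params. \<exists>y\<in>free_params. x \<noteq> y \<and> pi_map x = p \<and> pi_map y = p"
    if "p \<in> strict_markovian_params" for p :: "'n ph_params"
    by (rule two_preimages_of_strict[OF that])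
  show "\<exists>g :: 'n ph_params \<Rightarrow> real. g differentiable_on markovian_params \<and>
          (\<exists>x\<in>free_params. GDERIV (reparam g) x :> 0 \<and>
             \<not> local_extremum_on markovian_params g (pi_map x))"
    using critical_point_not_extremum by blast
  show "\<exists>g :: 'n ph_params \<Rightarrow> real. g differentiable_on UNIV \<and>
          (\<exists>x\<in>free_params. local_extremum_on free_params (reparam g) x \<and>
             \<not> local_extremum_on UNIV g (pi_map x))"
    using extremum_not_extremum_on_UNIV by blast
qed

end
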